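(* Let $a,b>0$ and $v\in(0,1)$. Put $h=\frac{b}{a}$, $r=\min\{v,1-v\}$, $R=\max\{v,1-v\}$, $r_1=\min\{2r,1-2r\}$ and $\hat r_1=\min\{2r_1,1-2r_1\}$. Then $$\frac{a+b}{2}\ \le\ R(\sqrt a-\sqrt b)^2-\frac12 r_1\Bigl[(\sqrt[4]{ab}-\sqrt a)^2+(\sqrt[4]{ab}-\sqrt b)^2\Bigr]+\mathrm{K}(\sqrt[4]{h},2)^{-\hat r_1}H_v(a,b).$$
   Context: For $t>0$, $\mathrm{K}(t,2)=\frac{(t+1)^2}{4t}$ denotes the Kantorovich constant. The Heinz mean is $H_v(a,b)=\frac{a^vb^{1-v}+a^{1-v}b^v}{2}$ for $a,b>0$, $0\le v\le1$. *)

theory Defs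
  imports Complex_Main
begin

(* The Kantorovich constant K(t,2); only the exponent 2 occurs. Meant for t > 0. *)
definition kantorovich2 :: "real \<Rightarrow> real" where
  "kantorovich2 t = (t + 1)\<^sup>2 / (4 * t)"

(* Meant for a, b > 0 and 0 \<le> v \<le> 1. *)
definition heinz_mean :: "real \<Rightarrow> real \<Rightarrow> real \<Rightarrow> real" where
  "heinz_mean v a b = (a powr v * b powr (1 - v) + a powr (1 - v) * b powr v) / 2"

end

theory Submission
  imports Defs "HOL-Analysis.Convex"
begin

text \<open>
  Weighted AM-GM applied to \<open>x\<close> and \<open>(x + y) / 2\<close>, together with
  \<open>((x + y) / 2)\<^sup>2 = K(y/x, 2) x y\<close>, gives Young's inequality with a Kantorovich factor.
  Applying it to \<open>x\<close> and \<open>\<surd>(x y)\<close> adds a quadratic refinement term.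
  For \<open>v \<le> 1/2\<close>, this refinement for \<open>b\<close>, \<open>\<surd>(a b)\<close> and weight \<open>2 v\<close> bounds
  \<open>(1 - 2 v) b + 2 v \<surd>(a b)\<close> from below by \<open>K\<^sup>s b\<^sup>1\<^sup>-\<^sup>v a\<^sup>v\<close> plus a square, and
  \<open>K\<^sup>s b\<^sup>1\<^sup>-\<^sup>v a\<^sup>v + K\<^sup>-\<^sup>s a\<^sup>1\<^sup>-\<^sup>v b\<^sup>v \<ge> 2 \<surd>(a b)\<close> reverses the inequality.
  Averaging over the exchange of \<open>a\<close> and \<open>b\<close> yields the Heinz mean.
\<close>

lemma kantorovich2_pos: "0 < t \<Longrightarrow> 0 < kantorovich2 t"
  by (simp add: kantorovich2_def)

lemma kantorovich2_inverse:
  assumes "0 < t"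
  shows "kantorovich2 (inverse t) = kantorovich2 t"
  using assms by (simp add: kantorovich2_def field_simps power2_eq_square)

lemma kantorovich2_divide_commute:
  assumes "0 < x" "0 < y"
  shows "kantorovich2 (x / y) = kantorovich2 (y / x)"
  using kantorovich2_inverse[of "y / x"] assms by simp

lemma arith_mean_square_eq_kantorovich2:
  assumes "0 < x" "0 < y"
  shows "((x + y) / 2)\<^sup>2 = kantorovich2 (y / x) * (x * y)"
  using assms by (simp add: kantorovich2_def field_simps power2_eq_square)

text \<open>The weights \<open>1 - 2 * w\<close> on \<open>x\<close> and \<open>2 * w\<close> on the
  midpoint are nonnegative because \<open>w \<le> 1 / 2\<close>, and their weighted arithmetic mean
  is that of \<open>x\<close> and \<open>y\<close> with weights \<open>1 - w\<close> and
  \<open>w\<close>.\<close>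

lemma kantorovich2_young_le_half:
  assumes "0 < x" "0 < y" "0 \<le> w" "w \<le> 1 / 2"
  shows "kantorovich2 (y / x) powr w * (x powr (1 - w) * y powr w) \<le> (1 - w) * x + w * y"
proof -
  let ?m = "(x + y) / 2"
  have m: "0 < ?m" and K: "0 < kantorovich2 (y / x)"
    using assms by (simp_all add: kantorovich2_pos)
  have "?m powr (2 * w) = (?m\<^sup>2) powr w"
    using m by (simp add: powr_powr flip: powr_numeral)
  also have "\<dots> = kantorovich2 (y / x) powr w * (x powr w * y powr w)"
    using assms K by (simp add: arith_mean_square_eq_kantorovich2 powr_mult)
  finally have "x powr (1 - 2 * w) * ?m powr (2 * w)
      = kantorovich2 (y / x) powr w * ((x powr (1 - 2 * w) * x powr w) * y powr w)"
    by simp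
  also have "x powr (1 - 2 * w) * x powr w = x powr (1 - w)"
    by (simp flip: powr_add)
  finally have "kantorovich2 (y / x) powr w * (x powr (1 - w) * y powr w)
      = x powr (1 - 2 * w) * ?m powr (2 * w)" by simp
  also have "\<dots> \<le> (1 - 2 * w) * x + 2 * w * ?m"
    using assms m by (intro Youngs_inequality_0) auto
  also have "\<dots> = (1 - w) * x + w * y"
    by (simp add: field_simps)
  finally show ?thesis .
qed

text \<open>Swapping \<open>x\<close> with \<open>y\<close> and \<open>w\<close> with
  \<open>1 - w\<close> reduces to weights at most 1/2, since the Kantorovich constant is the same at
  \<open>t\<close> and \<open>inverse t\<close>.\<close>

lemma kantorovich2_young:
  assumes "0 < x" "0 < y" "0 \<le> w" "w \<le> 1"
  shows "kantorovich2 (y / x) powr min w (1 - w) * (x powr (1 - w) * y powr w)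
    \<le> (1 - w) * x + w * y"
proof (cases "w \<le> 1 / 2")
  case True
  then show ?thesis using kantorovich2_young_le_half[of x y w] assms by (simp add: min_def)
next
  case False
  then show ?thesis
    using kantorovich2_young_le_half[of y x "1 - w"] assms
    by (simp add: min_def kantorovich2_divide_commute[of x y] ac_simps)
qed

text \<open>Subtracting the square from the right-hand side leaves
  \<open>(1 - 2 * w) * x + 2 * w * sqrt (x * y)\<close>, again a weighted arithmetic mean. The ratio
  of its two points is \<open>sqrt (y / x)\<close>, hence the argument of the constant.\<close>

lemma refined_kantorovich2_young_le_half:
  assumes "0 < x" "0 < y" "0 \<le> w" "w \<le> 1 / 2"
  shows "w * (sqrt x - sqrt y)\<^sup>2
      + kantorovich2 (sqrt (y / x)) powr min (2 * w) (1 - 2 * w) * (x powr (1 - w) * y powr w)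
    \<le> (1 - w) * x + w * y"
proof -
  let ?g = "sqrt (x * y)"
  have "?g powr (2 * w) = x powr w * y powr w"
    using assms by (simp add: powr_powr powr_mult flip: powr_half_sqrt)
  then have "x powr (1 - 2 * w) * ?g powr (2 * w) = (x powr (1 - 2 * w) * x powr w) * y powr w"
    by simp
  also have "x powr (1 - 2 * w) * x powr w = x powr (1 - w)"
    by (simp flip: powr_add)
  finally have P: "x powr (1 - 2 * w) * ?g powr (2 * w) = x powr (1 - w) * y powr w" .
  have "?g / x = sqrt (y / x)"
    using assms by (simp add: real_sqrt_mult real_sqrt_divide field_simps)
  then have "kantorovich2 (sqrt (y / x)) powr min (2 * w) (1 - 2 * w) * (x powr (1 - w) * y powr w)
      \<le> (1 - 2 * w) * x + 2 * w * ?g"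
    using kantorovich2_young[of x ?g "2 * w"] assms P by simp
  moreover have sq: "(sqrt x - sqrt y)\<^sup>2 = x + y - 2 * ?g"
    using assms by (simp add: power2_diff real_sqrt_mult)
  ultimately show ?thesis unfolding sq by (simp add: algebra_simps)
qed

lemma refined_kantorovich2_young:
  assumes "0 < x" "0 < y" "0 \<le> w" "w \<le> 1" and r: "r = min w (1 - w)"
  shows "r * (sqrt x - sqrt y)\<^sup>2
      + kantorovich2 (sqrt (y / x)) powr min (2 * r) (1 - 2 * r) * (x powr (1 - w) * y powr w)
    \<le> (1 - w) * x + w * y"
proof (cases "w \<le> 1 / 2")
  case True
  then have "r = w" using r by simp
  then show ?thesis using refined_kantorovich2_young_le_half[of x y w] assms True by simp
next
  case False
  then have "r = 1 - w" using r by simp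
  moreover have "kantorovich2 (sqrt (x / y)) = kantorovich2 (sqrt (y / x))"
    using assms by (simp add: real_sqrt_divide kantorovich2_divide_commute)
  ultimately show ?thesis
    using refined_kantorovich2_young_le_half[of y x "1 - w"] assms False
    by (simp add: power2_commute ac_simps)
qed

text \<open>With \<open>g = sqrt (a * b)\<close>, moving the \<open>(1 - v)\<close> square to the
  left leaves \<open>2 * g - ((1 - 2 * v) * b + 2 * v * g)\<close>, so a lower bound on the bracket
  gives an upper bound here.\<close>

lemma reverse_kantorovich2_young_le_half:
  assumes "0 < a" "0 < b" "0 \<le> v" "v \<le> 1 / 2"
    and r: "r = min (2 * v) (1 - 2 * v)" and s: "s = min (2 * r) (1 - 2 * r)"
  shows "(1 - v) * a + v * b
    \<le> (1 - v) * (sqrt a - sqrt b)\<^sup>2 - r * (root 4 (a * b) - sqrt b)\<^sup>2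
      + kantorovich2 (root 4 (b / a)) powr (- s) * (a powr (1 - v) * b powr v)"
proof -
  let ?g = "sqrt (a * b)" and ?K = "kantorovich2 (root 4 (b / a))"
  have root4: "root 4 t = sqrt (sqrt t)" for t
    by (simp add: sqrt_def flip: real_root_mult_exp)
  have K: "0 < ?K" using assms by (simp add: kantorovich2_pos)
  have "?g powr (2 * v) = a powr v * b powr v"
    using assms by (simp add: powr_powr powr_mult flip: powr_half_sqrt)
  then have "b powr (1 - 2 * v) * ?g powr (2 * v) = (b powr (1 - 2 * v) * b powr v) * a powr v"
    by simp
  also have "b powr (1 - 2 * v) * b powr v = b powr (1 - v)"
    by (simp flip: powr_add)
  finally have P: "b powr (1 - 2 * v) * ?g powr (2 * v) = b powr (1 - v) * a powr v" .
  have "?g / b = sqrt (a / b)"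
    using assms by (simp add: real_sqrt_mult real_sqrt_divide field_simps)
  then have KE: "kantorovich2 (sqrt (?g / b)) = ?K"
    using assms by (simp add: root4 real_sqrt_divide kantorovich2_divide_commute)
  define X where "X = ?K powr s * (b powr (1 - v) * a powr v)"
  define Y where "Y = ?K powr (- s) * (a powr (1 - v) * b powr v)"
  \<comment> \<open>The weight \<open>2 * v\<close> may exceed 1/2, so the refinement for all
    weights in [0, 1] is required.\<close>
  have "r * (sqrt b - sqrt ?g)\<^sup>2 + ?K powr s * (b powr (1 - 2 * v) * ?g powr (2 * v))
      \<le> (1 - 2 * v) * b + 2 * v * ?g"
    using refined_kantorovich2_young[of b ?g "2 * v" r] assms unfolding KE by simp
  then have X: "r * (root 4 (a * b) - sqrt b)\<^sup>2 + X \<le> (1 - 2 * v) * b + 2 * v * ?g"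
    unfolding P X_def root4 by (simp add: power2_commute)
  \<comment> \<open>The opposite exponents cancel the Kantorovich factors, so the geometric mean of
    \<open>X\<close> and \<open>Y\<close> is exactly \<open>?g\<close>.\<close>
  have "X * Y = (?K powr s * ?K powr (- s)) * (a powr v * a powr (1 - v))
      * (b powr v * b powr (1 - v))"
    unfolding X_def Y_def by (simp only: ac_simps)
  also have "\<dots> = a * b"
    using assms K by (simp flip: powr_add)
  finally have "?g = sqrt (X * Y)" by simp
  moreover have "0 \<le> X" "0 \<le> Y" using assms by (simp_all add: X_def Y_def)
  ultimately have "2 * ?g \<le> X + Y"
    using arith_geo_mean_sqrt[of X Y] by simp
  moreover have sq: "(sqrt a - sqrt b)\<^sup>2 = a + b - 2 * ?g"
    using assms by (simp add: power2_diff real_sqrt_mult)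
  ultimately show ?thesis using X unfolding sq Y_def[symmetric]
    by (simp add: algebra_simps)
qed

lemma reverse_kantorovich2_heinz_le_half:
  assumes "0 < a" "0 < b" "0 \<le> v" "v \<le> 1 / 2"
    and "r = min (2 * v) (1 - 2 * v)" and "s = min (2 * r) (1 - 2 * r)"
  shows "(a + b) / 2
    \<le> (1 - v) * (sqrt a - sqrt b)\<^sup>2
      - 1 / 2 * r * ((root 4 (a * b) - sqrt a)\<^sup>2 + (root 4 (a * b) - sqrt b)\<^sup>2)
      + kantorovich2 (root 4 (b / a)) powr (- s) * heinz_mean v a b"
proof -
  have "kantorovich2 (root 4 (a / b)) = kantorovich2 (root 4 (b / a))"
    using assms by (simp add: real_root_divide kantorovich2_divide_commute)
  then show ?thesis
    using reverse_kantorovich2_young_le_half[of a b v r s]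
      reverse_kantorovich2_young_le_half[of b a v r s] assms
    by (simp add: heinz_mean_def power2_commute[of "sqrt b" "sqrt a"] mult.commute[of b a]
        field_simps)
qed

lemma heinz_mean_one_minus: "heinz_mean (1 - v) a b = heinz_mean v a b"
  by (simp add: heinz_mean_def)

theorem mainTheorem8:
  fixes a b v h r R r\<^sub>1 r\<^sub>1_hat :: real
  assumes "a > 0" and "b > 0"
    and "v \<in> {0<..<1}"
    and "h = b / a"
    and "r = min v (1 - v)"
    and "R = max v (1 - v)"
    and "r\<^sub>1 = min (2 * r) (1 - 2 * r)"
    and "r\<^sub>1_hat = min (2 * r\<^sub>1) (1 - 2 * r\<^sub>1)"
  shows "(a + b) / 2 \<le>
      R * (sqrt a - sqrt b)\<^sup>2
      - 1 / 2 * r\<^sub>1 * ((root 4 (a * b) - sqrt a)\<^sup>2 + (root 4 (a * b) - sqrt b)\<^sup>2)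
      + kantorovich2 (root 4 h) powr (- r\<^sub>1_hat) * heinz_mean v a b"
proof -
  \<comment> \<open>Both sides are invariant under exchanging \<open>v\<close> and
    \<open>1 - v\<close>, so \<open>r\<close> can stand in for \<open>v\<close>.\<close>
  have "R = 1 - r" "heinz_mean r a b = heinz_mean v a b"
    using assms(5,6) by (auto simp: min_def max_def heinz_mean_one_minus)
  moreover have "0 \<le> r" "r \<le> 1 / 2" using assms(3,5) by (auto simp: min_def)
  ultimately show ?thesis
    using reverse_kantorovich2_heinz_le_half[of a b r r\<^sub>1 r\<^sub>1_hat] assms(1,2,4,7,8) by simp
qed

end
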